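(* If $T$ is a tree with $n$ vertices and $\Delta(T)\le 4$, then $b(T)\le 2\log_2(n+2)-4$.
   Context: Grid: the rectangular grid of horizontal and vertical lines through integer points. An s-model of a tree $T$ with $\Delta(T)\le 4$ is a drawing of $T$ in the grid with vertices at distinct grid points and each edge a straight (bend-free) horizontal or vertical grid segment, segments of distinct edges meeting only at common endpoints; $\mathcal{M}(T)$ is the set of s-models. The number of bends of a path of $T$ in $\mathcal{M}$ is the number of turns between horizontal and vertical of the grid path formed by concatenating the segments of its edges; $b_{\mathcal{M}}(u,w)$ is this number for the $u$–$w$ path. $b(\mathcal{M})=\max\{b_{\mathcal{M}}(u,w):u,w\text{ leaves of }T\}$ and $b(T)=\min\{b(\mathcal{M}):\mathcal{M}\in\mathcal{M}(T)\}$. *)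

theory Defs
  imports "HOL-Analysis.Analysis"
begin

section \<open>Finite simple graphs and trees\<close>

definition simple_graph :: "'a set \<Rightarrow> 'a set set \<Rightarrow> bool" where
  "simple_graph V E \<longleftrightarrow> finite V \<and> (\<forall>e\<in>E. e \<subseteq> V \<and> card e = 2)"

definition degree_of :: "'a set set \<Rightarrow> 'a \<Rightarrow> nat" where
  "degree_of E v = card {e \<in> E. v \<in> e}"

definition max_degree :: "'a set \<Rightarrow> 'a set set \<Rightarrow> nat" where
  "max_degree V E = Max (degree_of E ` V)"

definition leaves :: "'a set \<Rightarrow> 'a set set \<Rightarrow> 'a set" where
  "leaves V E = {v \<in> V. degree_of E v = 1}"

definition simple_path :: "'a set \<Rightarrow> 'a set set \<Rightarrow> 'a \<Rightarrow> 'a list \<Rightarrow> 'a \<Rightarrow> bool" where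
  "simple_path V E u p w \<longleftrightarrow>
     p \<noteq> [] \<and> hd p = u \<and> last p = w \<and> set p \<subseteq> V \<and> distinct p \<and>
     successively (\<lambda>x y. {x, y} \<in> E) p"

definition simple_cycle :: "'a set \<Rightarrow> 'a set set \<Rightarrow> 'a list \<Rightarrow> bool" where
  "simple_cycle V E c \<longleftrightarrow>
     length c \<ge> 3 \<and> set c \<subseteq> V \<and> distinct c \<and>
     successively (\<lambda>x y. {x, y} \<in> E) c \<and> {last c, hd c} \<in> E"

definition tree_graph :: "'a set \<Rightarrow> 'a set set \<Rightarrow> bool" where
  "tree_graph V E \<longleftrightarrow>
     simple_graph V E \<and> V \<noteq> {} \<and>
     (\<forall>u\<in>V. \<forall>w\<in>V. \<exists>p. simple_path V E u p w) \<and>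
     (\<nexists>c. simple_cycle V E c)"

definition tree_path :: "'a set \<Rightarrow> 'a set set \<Rightarrow> 'a \<Rightarrow> 'a \<Rightarrow> 'a list" where
  "tree_path V E u w = (THE p. simple_path V E u p w)"

section \<open>Bend-free drawings in the grid\<close>

definition horizontal :: "int \<times> int \<Rightarrow> int \<times> int \<Rightarrow> bool" where
  "horizontal a b \<longleftrightarrow> a \<noteq> b \<and> snd a = snd b"

definition vertical :: "int \<times> int \<Rightarrow> int \<times> int \<Rightarrow> bool" where
  "vertical a b \<longleftrightarrow> a \<noteq> b \<and> fst a = fst b"

definition plane_point :: "int \<times> int \<Rightarrow> real \<times> real" where
  "plane_point a = (real_of_int (fst a), real_of_int (snd a))"

text \<open>An edge of two endpoints is drawn as the convex hull of their positions, that is, as the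
  closed segment joining them.\<close>

definition edge_segment :: "('a \<Rightarrow> int \<times> int) \<Rightarrow> 'a set \<Rightarrow> (real \<times> real) set" where
  "edge_segment M e = convex hull ((\<lambda>v. plane_point (M v)) ` e)"

text \<open>A drawing is given by the positions of the vertices; its values outside \<open>V\<close> are
  irrelevant.\<close>

definition s_models :: "'a set \<Rightarrow> 'a set set \<Rightarrow> ('a \<Rightarrow> int \<times> int) set" where
  "s_models V E = {M.
     inj_on M V \<and>
     (\<forall>u v. {u, v} \<in> E \<longrightarrow> horizontal (M u) (M v) \<or> vertical (M u) (M v)) \<and>
     (\<forall>e\<in>E. \<forall>f\<in>E. e \<noteq> f \<longrightarrow>
        edge_segment M e \<inter> edge_segment M f \<subseteq> (\<lambda>v. plane_point (M v)) ` (e \<inter> f))}"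

section \<open>Bends\<close>

definition turns :: "(int \<times> int) list \<Rightarrow> nat" where
  "turns q = card {i. i + 2 < length q \<and>
     (horizontal (q ! i) (q ! (i + 1)) \<and> vertical (q ! (i + 1)) (q ! (i + 2)) \<or>
      vertical (q ! i) (q ! (i + 1)) \<and> horizontal (q ! (i + 1)) (q ! (i + 2)))}"

definition path_bends ::
    "'a set \<Rightarrow> 'a set set \<Rightarrow> ('a \<Rightarrow> int \<times> int) \<Rightarrow> 'a \<Rightarrow> 'a \<Rightarrow> nat" where
  "path_bends V E M u w = turns (map M (tree_path V E u w))"

text \<open>The maximum over the leaves and the minimum over the models are taken as supremum and
  infimum in the extended reals. For a tree with an edge the supremum ranges over a nonempty
  finite set of naturals, so it is a maximum, and the infimum of such values over a nonempty set
  of models is attained. The degenerate cases get their order-theoretic values: the one-vertex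
  tree has no leaf, which gives the value \<open>-\<infinity>\<close>, and a tree without any model
  would get \<open>\<infinity>\<close>, so that an upper bound on \<open>bend_number\<close> below
  \<open>\<infinity>\<close> includes the existence of a model.\<close>

definition model_bends :: "'a set \<Rightarrow> 'a set set \<Rightarrow> ('a \<Rightarrow> int \<times> int) \<Rightarrow> ereal" where
  "model_bends V E M =
     (SUP (u, w) \<in> leaves V E \<times> leaves V E. ereal (real (path_bends V E M u w)))"

definition bend_number :: "'a set \<Rightarrow> 'a set set \<Rightarrow> ereal" where
  "bend_number V E = (INF M \<in> s_models V E. model_bends V E M)"

end

(* Root the tree at a centroid and draw it so that, away from the root, the child with the largest
   subtree continues straight ahead, while at the root the two largest children are opposite each
   other and so are the remaining two. Every turn met while descending at least halves the subtree,
   so t turns below a child c force 2 * 2^t <= s(c) + 1, where s counts the vertices of a subtree.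
   A path climbs from one end to the top a of the path and descends again. If a is the root, a turn
   at a comes with a third child at least as large as one of the two that are used; if a is not the
   root, its whole subtree holds at most half of the vertices. AM-GM then gives
   2^(b + 4) <= (n + 2)^2 for a path with b bends.
   The directions can be realised without crossings because the edge lengths shrink by the factor 3
   from level to level: seen from a vertex, everything below a child stays in the open quadrant
   around the direction of that child. *)
theory Submission
  imports Defs
begin

section \<open>Uniqueness of simple paths in acyclic graphs\<close>

lemma simple_path_ConsD:
  assumes "simple_path V E u (u # p) w" and "p \<noteq> []"
  shows "simple_path V E (hd p) p w" "{u, hd p} \<in> E" "u \<notin> set p"
  using assms by (auto simp: simple_path_def successively_Cons)

lemma simple_path_rev:
  assumes "simple_path V E u p w"
  shows "simple_path V E w (rev p) u"
  using assms by (simp add: simple_path_def hd_rev last_rev insert_commute)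

text \<open>Where two paths part, the first can be followed until it meets the second again;
  returning along the second closes a cycle.\<close>

lemma simple_path_unique:
  assumes acyclic: "\<nexists>c. simple_cycle V E c"
    and "simple_path V E u p w" and "simple_path V E u q w"
  shows "p = q"
  using assms(2,3)
proof (induction p arbitrary: u q)
  case Nil
  then show ?case by (simp add: simple_path_def)
next
  case (Cons a p)
  have a: "a = u" using Cons.prems by (simp add: simple_path_def)
  obtain q' where q: "q = u # q'"
    using Cons.prems by (cases q) (auto simp: simple_path_def)
  show ?case
  proof (cases "p = [] \<or> q' = []")
    case True
    then show ?thesis using Cons.prems a q
      by (auto simp: simple_path_def split: if_splits)
  next
    case False
    note P = simple_path_ConsD[of V E u p w] and Q = simple_path_ConsD[of V E u q' w]
    have sp: "simple_path V E (hd p) p w" "{u, hd p} \<in> E" "u \<notin> set p"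
      using P Cons.prems a False by auto
    have sq: "simple_path V E (hd q') q' w" "{u, hd q'} \<in> E" "u \<notin> set q'"
      using Q Cons.prems q False by auto
    show ?thesis
    proof (cases "hd p = hd q'")
      case True
      then show ?thesis using Cons.IH[of "hd p" q'] sp sq a q by simp
    next
      case heads: False
      have "w \<in> set p \<and> w \<in> set q'"
        using sp(1) sq(1) False last_in_set[of p] last_in_set[of q'] by (simp add: simple_path_def)
      then have "\<exists>x\<in>set p. x \<in> set q'" by blast
      then obtain p1 x p2 where p: "p = p1 @ x # p2" and x: "x \<in> set q'"
        and p1: "\<forall>y\<in>set p1. y \<notin> set q'"
        by (rule split_list_first_propE)
      obtain q1 q2 where q': "q' = q1 @ x # q2" using x by (meson split_list)
      let ?c = "u # p1 @ x # rev q1"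
      \<comment> \<open>If both pieces were empty, \<open>x\<close> would be the head of
        \<open>p\<close> and of \<open>q'\<close>; hence the closed walk has a third vertex.\<close>
      have "p1 \<noteq> [] \<or> q1 \<noteq> []" using heads p q' by auto
      then have "length ?c \<ge> 3" by (cases p1; cases q1) auto
      moreover have "set ?c \<subseteq> V" "distinct ?c"
        using Cons.prems a q p q' p1 sp(3) sq(3) by (auto simp: simple_path_def)
      moreover have "successively (\<lambda>x y. {x, y} \<in> E) ?c"
      proof -
        have "successively (\<lambda>x y. {x, y} \<in> E) ((u # p1 @ [x]) @ p2)"
          using Cons.prems(1) a p by (simp add: simple_path_def)
        then have 1: "successively (\<lambda>x y. {x, y} \<in> E) (u # p1 @ [x])"
          unfolding successively_append_iff by blast
        have "successively (\<lambda>x y. {x, y} \<in> E) ((q1 @ [x]) @ q2)"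
          using sq(1) q' by (simp add: simple_path_def)
        then have "successively (\<lambda>x y. {x, y} \<in> E) (q1 @ [x])"
          unfolding successively_append_iff by blast
        then have "successively (\<lambda>x y. {x, y} \<in> E) (rev (q1 @ [x]))"
          by (subst successively_rev) (simp add: insert_commute)
        with 1 show ?thesis
          by (auto simp: successively_append_iff successively_Cons hd_append)
      qed
      moreover have "{last ?c, hd ?c} \<in> E"
        using sq(2) q' by (cases q1) (auto simp: insert_commute)
      ultimately have "simple_cycle V E ?c" by (simp add: simple_cycle_def)
      then show ?thesis using acyclic by blast
    qed
  qed
qed

section \<open>Paths in trees\<close>

locale tree =
  fixes V :: "'a set" and E :: "'a set set"
  assumes tree: "tree_graph V E"
begin

lemma finite_V: "finite V"
  and acyclic: "\<nexists>c. simple_cycle V E c"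
  using tree by (auto simp: tree_graph_def simple_graph_def)

lemma edgeD:
  assumes "{x, y} \<in> E"
  shows "x \<in> V" "y \<in> V" "x \<noteq> y"
  using assms tree by (force simp: tree_graph_def simple_graph_def)+

lemma edge_cases:
  assumes "e \<in> E"
  obtains x y where "e = {x, y}" "x \<noteq> y"
proof -
  have "card e = 2" using assms tree by (auto simp: tree_graph_def simple_graph_def)
  then show thesis using that by (auto simp: card_2_iff)
qed

lemma finite_E: "finite E"
  using tree by (intro finite_subset[of E "Pow V"]) (auto simp: tree_graph_def simple_graph_def)

lemma simple_path_tree_path:
  assumes "u \<in> V" "w \<in> V"
  shows "simple_path V E u (tree_path V E u w) w"
proof -
  have "\<exists>!p. simple_path V E u p w"
    using tree assms simple_path_unique[OF acyclic] by (auto simp: tree_graph_def)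
  then show ?thesis unfolding tree_path_def by (rule theI')
qed

lemma tree_path_eqI: "simple_path V E u p w \<Longrightarrow> tree_path V E u w = p"
  unfolding tree_path_def using simple_path_unique[OF acyclic] by blast

end

section \<open>Rooted trees\<close>

locale rooted_tree = tree +
  fixes r :: 'a
  assumes root_in: "r \<in> V"
begin

abbreviation P :: "'a \<Rightarrow> 'a list" where "P \<equiv> tree_path V E r"

text \<open>Parenthood is encoded through root paths, so that ancestry becomes a prefix relation on
  lists and \<open>sub x\<close> is the vertex set of the subtree hanging from
  \<open>x\<close>.\<close>

definition child :: "'a \<Rightarrow> 'a \<Rightarrow> bool" where
  "child x y \<longleftrightarrow> x \<in> V \<and> y \<in> V \<and> P y = P x @ [y]"

definition sub :: "'a \<Rightarrow> 'a set" where
  "sub x = {w \<in> V. x \<in> set (P w)}"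

lemma P_path: "w \<in> V \<Longrightarrow> simple_path V E r (P w) w"
  by (rule simple_path_tree_path[OF root_in])

lemma P_props:
  assumes "w \<in> V"
  shows "P w \<noteq> []" "hd (P w) = r" "last (P w) = w" "set (P w) \<subseteq> V" "distinct (P w)"
  using P_path[OF assms] by (auto simp: simple_path_def)

lemma P_root [simp]: "P r = [r]"
  by (rule tree_path_eqI) (auto simp: simple_path_def root_in)

lemma self_in_P: "w \<in> V \<Longrightarrow> w \<in> set (P w)"
  using P_props[of w] by (metis last_in_set)

text \<open>Initial pieces of simple paths are simple, so uniqueness identifies them as root
  paths.\<close>

lemma P_prefix:
  assumes "w \<in> V" "P w = a @ y # b"
  shows "y \<in> V" "P y = a @ [y]"
proof -
  show "y \<in> V" using P_props(4)[OF assms(1)] assms(2) by auto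
  have "simple_path V E r ((a @ [y]) @ b) w" using P_path[OF assms(1)] assms(2) by simp
  then have "simple_path V E r (a @ [y]) y"
    unfolding simple_path_def successively_append_iff[of _ "a @ [y]"] by (auto simp: hd_append)
  then show "P y = a @ [y]" by (rule tree_path_eqI)
qed

lemma P_through:
  assumes "w \<in> V" "x \<in> set (P w)"
  obtains b where "P w = P x @ b"
proof -
  obtain a b where ab: "P w = a @ x # b" using assms by (meson split_list)
  then have "P w = P x @ b" using P_prefix(2)[OF assms(1) ab] by simp
  then show thesis by (rule that)
qed

text \<open>If \<open>y\<close> is not on the root path of \<open>x\<close>, that path extends to
  \<open>y\<close>. Otherwise its final piece from \<open>y\<close> to \<open>x\<close> and the edge
  itself are two paths with the same ends, hence equal.\<close>

lemma edge_child:
  assumes xy: "{x, y} \<in> E"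
  shows "child x y \<or> child y x"
proof (cases "y \<in> set (P x)")
  case False
  have "simple_path V E r (P x @ [y]) y"
    using P_path[of x] edgeD[OF xy] False xy
    by (auto simp: simple_path_def successively_append_iff)
  then show ?thesis using edgeD[OF xy] by (auto simp: child_def intro: tree_path_eqI)
next
  case True
  note V = edgeD[OF xy]
  obtain a b where ab: "P x = a @ y # b" using True by (meson split_list)
  have Py: "P y = a @ [y]" using P_prefix[OF V(1) ab] by simp
  have "simple_path V E y (y # b) x"
    using P_path[OF V(1)] ab by (auto simp: simple_path_def successively_append_iff split: if_splits)
  moreover have "simple_path V E y [y, x] x"
    using V xy by (auto simp: simple_path_def insert_commute)
  ultimately have "b = [x]" using simple_path_unique[OF acyclic] by blast
  then show ?thesis using ab Py V by (simp add: child_def)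
qed

lemma child_edge:
  assumes "child x y"
  shows "{x, y} \<in> E"
proof -
  have "simple_path V E r (P x @ [y]) y" using assms P_path[of y] by (simp add: child_def)
  moreover have "P x \<noteq> []" "last (P x) = x" using assms P_props by (auto simp: child_def)
  ultimately show ?thesis by (auto simp: simple_path_def successively_append_iff)
qed

lemma child_neq_root: "child x y \<Longrightarrow> y \<noteq> r"
  using P_props(1)[of x] P_root by (auto simp: child_def)

lemma parent_unique: "child x y \<Longrightarrow> child x' y \<Longrightarrow> x = x'"
  using P_props(3) by (metis append1_eq_conv child_def)

lemma child_snoc:
  assumes "w \<in> V" "P w = l @ [z]" "l \<noteq> []"
  shows "child (last l) w" "P (last l) = l"
proof -
  have z: "z = w" using P_props(3)[OF assms(1)] assms(2) by simp
  have "P w = butlast l @ last l # [z]" using assms by simp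
  from P_prefix[OF assms(1) this] assms z
  show "child (last l) w" "P (last l) = l" by (auto simp: child_def)
qed

lemma parent_exists:
  assumes "y \<in> V" "y \<noteq> r"
  obtains x where "child x y"
proof -
  have Py: "P y = butlast (P y) @ [y]" using P_props(1,3)[OF assms(1)] by (metis append_butlast_last_id)
  have "butlast (P y) \<noteq> []"
  proof
    assume "butlast (P y) = []"
    then have "P y = [y]" using Py by simp
    then show False using P_props(2)[OF assms(1)] assms(2) by simp
  qed
  then show thesis using child_snoc(1)[OF assms(1) Py] that by blast
qed

section \<open>Subtrees and lowest common ancestors\<close>

lemma sub_self: "x \<in> V \<Longrightarrow> x \<in> sub x"
  by (simp add: sub_def self_in_P)

lemma finite_sub: "finite (sub x)"
  using finite_V by (simp add: sub_def)

lemma sub_trans: "y \<in> sub x \<Longrightarrow> sub y \<subseteq> sub x"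
proof
  fix w assume y: "y \<in> sub x" and w: "w \<in> sub y"
  then obtain b where "P w = P y @ b" using P_through[of w y] by (auto simp: sub_def)
  then show "w \<in> sub x" using y w by (simp add: sub_def)
qed

lemma child_in_sub: "child x y \<Longrightarrow> y \<in> sub x"
  using self_in_P by (auto simp: sub_def child_def)

lemma notin_sub_child: "child x y \<Longrightarrow> x \<notin> sub y"
  using P_props(5)[of y] by (auto simp: sub_def child_def)

text \<open>A vertex below both would have \<open>P y\<close> and \<open>P z\<close> as prefixes of
  its root path; these have equal length, so they would coincide.\<close>

lemma children_sub_disjoint:
  assumes "child x y" "child x z" "y \<noteq> z"
  shows "sub y \<inter> sub z = {}"
proof -
  have False if w: "w \<in> V" "y \<in> set (P w)" "z \<in> set (P w)" for w
  proof -
    obtain b c where "P w = P y @ b" "P w = P z @ c" using w P_through by metis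
    then show False using assms by (auto simp: child_def)
  qed
  then show ?thesis by (auto simp: sub_def)
qed

text \<open>The subtrees are disjoint and miss \<open>x\<close>, which supplies the
  \<open>+ 1\<close>. Since \<open>C\<close> is any selection of children, the bound can be applied
  to one, two or three chosen ones.\<close>

lemma card_sub_children:
  assumes "x \<in> V" and C: "finite C" "C \<subseteq> {y. child x y}"
  shows "(\<Sum>y\<in>C. card (sub y)) + 1 \<le> card (sub x)"
proof -
  have "(\<Sum>y\<in>C. card (sub y)) = card (\<Union>y\<in>C. sub y)"
    using C(1) children_sub_disjoint[of x] C(2) finite_sub
    by (subst card_UN_disjoint) (auto simp: subset_iff)
  also have "card (\<Union>y\<in>C. sub y) + 1 = card (insert x (\<Union>y\<in>C. sub y))"
    using C notin_sub_child finite_sub by (subst card_insert_disjoint) (auto simp: subset_iff)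
  also have "\<dots> \<le> card (sub x)"
    using C sub_self[OF assms(1)] child_in_sub sub_trans
    by (intro card_mono finite_sub) blast
  finally show ?thesis .
qed

lemma sub_root: "sub r = V"
proof -
  have "r \<in> set (P w)" if "w \<in> V" for w
    using P_props(1,2)[OF that] hd_in_set[of "P w"] by simp
  then show ?thesis by (auto simp: sub_def)
qed

text \<open>\<open>a\<close> is the lowest common ancestor, the end of the longest common prefix of
  the two root paths.\<close>

lemma P_common:
  assumes "u \<in> V" "w \<in> V"
  obtains a p q where "a \<in> V" "P u = P a @ p" "P w = P a @ q"
    "p = [] \<or> q = [] \<or> hd p \<noteq> hd q"
proof -
  obtain c p q where c: "P u = c @ p" "P w = c @ q" "p = [] \<or> q = [] \<or> hd p \<noteq> hd q"
    by (metis longest_common_prefix list.sel(1))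
  have "c \<noteq> []"
    using c P_props(1,2)[OF assms(1)] P_props(1,2)[OF assms(2)] by auto
  then have "P u = butlast c @ last c # p" using c(1) by simp
  from P_prefix[OF assms(1) this] \<open>c \<noteq> []\<close> have "last c \<in> V" "P (last c) = c" by auto
  then show thesis using c that[of "last c" p q] by simp
qed

lemma child_on_P:
  assumes "w \<in> V" "a \<in> V" "P w = P a @ c # b"
  shows "child a c" "w \<in> sub c"
  using assms P_prefix[OF assms(1,3)] by (auto simp: child_def sub_def)

text \<open>The two legs meet only in \<open>a\<close>: a common vertex has just one root path,
  which would force both legs to start with the same child.\<close>

lemma tree_path_via:
  assumes V: "u \<in> V" "w \<in> V" "a \<in> V"
    and u: "P u = P a @ p" and w: "P w = P a @ q"
    and div: "p = [] \<or> q = [] \<or> hd p \<noteq> hd q"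
  shows "tree_path V E u w = rev p @ a # q"
proof -
  obtain c where Pa: "P a = c @ [a]"
    using P_props(1,3)[OF V(3)] by (metis append_butlast_last_id)
  have "simple_path V E r (c @ (a # p)) u" "simple_path V E r (c @ (a # q)) w"
    using P_path V u w Pa by fastforce+
  then have ap: "simple_path V E a (a # p) u" and aq: "simple_path V E a (a # q) w"
    by (auto simp: simple_path_def successively_append_iff split: if_splits)
  have "set p \<inter> set q = {}"
  proof (rule ccontr)
    assume "set p \<inter> set q \<noteq> {}"
    then obtain z p1 p2 q1 q2 where z: "p = p1 @ z # p2" "q = q1 @ z # q2"
      by (meson disjoint_iff split_list)
    have "P z = (P a @ p1) @ [z]" using u z by (intro P_prefix(2)[OF V(1)]) simp
    moreover have "P z = (P a @ q1) @ [z]" using w z by (intro P_prefix(2)[OF V(2)]) simp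
    ultimately have "p1 = q1" by simp
    then show False using z div by (cases p1) auto
  qed
  moreover have "simple_path V E u (rev p @ [a]) a" using simple_path_rev[OF ap] by simp
  ultimately have "simple_path V E u (rev p @ a # q) w"
    using aq by (cases q; cases p) (auto simp: simple_path_def successively_append_iff successively_Cons hd_append)
  then show ?thesis by (rule tree_path_eqI)
qed

end

section \<open>Existence of a centroid\<close>

context tree
begin

text \<open>A vertex minimising the total distance to all vertices: moving the root to a child
  shortens the distance to every vertex below that child and lengthens all others by one.\<close>

lemma centroid_exists:
  obtains r where "rooted_tree V E r"
    "\<And>y. rooted_tree.child V E r r y \<Longrightarrow> 2 * card (rooted_tree.sub V E r y) \<le> card V"
proof -
  define S where "S r = (\<Sum>w\<in>V. length (tree_path V E r w))" for r
  have "\<exists>r. r \<in> V" using tree by (auto simp: tree_graph_def)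
  then obtain r where r: "r \<in> V" and min: "\<And>y. y \<in> V \<Longrightarrow> S r \<le> S y"
    using ex_has_least_nat[of "\<lambda>r. r \<in> V" _ S] by blast
  interpret rooted_tree V E r by unfold_locales (rule r)
  have "2 * card (sub y) \<le> card V" if y: "child r y" for y
  proof -
    have yV: "y \<in> V" and Py: "P y = [r, y]" using y by (auto simp: child_def)
    have len: "length (tree_path V E y w) \<le> (if w \<in> sub y then length (P w) - 1 else length (P w) + 1)"
      if w: "w \<in> V" for w
    proof (cases "w \<in> sub y")
      case True
      then obtain b where b: "P w = r # y # b" using P_through[OF w, of y] Py by (auto simp: sub_def)
      have "simple_path V E y (y # b) w" using P_path[OF w] b by (auto simp: simple_path_def)
      then show ?thesis using True b tree_path_eqI by fastforce
    next
      case False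
      then have "y \<notin> set (P w)" using w by (simp add: sub_def)
      then have "simple_path V E y (y # P w) w"
        using P_path[OF w] yV child_edge[OF y]
        by (auto simp: simple_path_def successively_Cons insert_commute)
      then show ?thesis using False tree_path_eqI by fastforce
    qed
    have pos: "length (P w) \<ge> 1" if "w \<in> V" for w
      using P_props(1)[OF that] by (simp add: Suc_le_eq)
    have subV: "sub y \<subseteq> V" by (auto simp: sub_def)
    \<comment> \<open>Integers are used because the change per vertex is -1 below \<open>y\<close>
      and +1 elsewhere.\<close>
    have "int (S y) \<le> (\<Sum>w\<in>V. int (length (P w)) + (if w \<in> sub y then - 1 else 1))"
      unfolding S_def of_nat_sum
      by (rule sum_mono) (use len pos in \<open>force split: if_splits\<close>)
    also have "\<dots> = int (S r) + (\<Sum>w\<in>V. if w \<in> sub y then - 1 else 1)"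
      by (simp add: S_def sum.distrib)
    also have "(\<Sum>w\<in>V. if w \<in> sub y then - 1 else 1 :: int) = int (card (V - sub y)) - int (card (sub y))"
      using finite_V subV by (simp add: sum.If_cases Int_absorb1 Diff_eq)
    also have "int (card (V - sub y)) = int (card V) - int (card (sub y))"
      using finite_V finite_sub subV by (simp add: card_Diff_subset card_mono of_nat_diff)
    \<comment> \<open>The total change is at most \<open>card V - 2 * card (sub y)\<close>;
      minimality at \<open>r\<close> keeps it from being negative.\<close>
    finally show ?thesis using min[OF yV] by linarith
  qed
  then show thesis using that rooted_tree_axioms by blast
qed

end

section \<open>Counting turns\<close>

text \<open>The condition at a single index in \<open>turns\<close>, isolated so that
  \<open>turns\<close> can be computed along the list.\<close>

definition bend :: "int \<times> int \<Rightarrow> int \<times> int \<Rightarrow> int \<times> int \<Rightarrow> bool" where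
  "bend a b c \<longleftrightarrow> horizontal a b \<and> vertical b c \<or> vertical a b \<and> horizontal b c"

lemma bend_commute: "bend a b c \<longleftrightarrow> bend c b a"
  by (auto simp: bend_def horizontal_def vertical_def)

lemma turns_short [simp]: "turns [] = 0" "turns [a] = 0" "turns [a, b] = 0"
  by (simp_all add: turns_def)

lemma turns_Cons [simp]:
  "turns (a # b # c # xs) = of_bool (bend a b c) + turns (b # c # xs)"
proof -
  let ?Q = "\<lambda>q i. i + 2 < length q \<and> bend (q ! i) (q ! (i + 1)) (q ! (i + 2))"
  let ?A = "{i. ?Q (b # c # xs) i}"
  have t: "turns q = card {i. ?Q q i}" for q
    by (simp add: turns_def bend_def)
  have "{i. ?Q (a # b # c # xs) i} = (if bend a b c then {0} else {}) \<union> Suc ` ?A"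
  proof (rule set_eqI)
    fix i show "i \<in> {i. ?Q (a # b # c # xs) i} \<longleftrightarrow>
        i \<in> (if bend a b c then {0} else {}) \<union> Suc ` ?A"
      by (cases i) (auto simp: image_iff)
  qed
  moreover have "finite ?A" by (rule finite_subset[of _ "{..length xs}"]) auto
  ultimately show ?thesis
    unfolding t by (auto simp: card_image card_Un_disjoint)
qed

lemma turns_append:
  "turns (xs @ b # a # c # ys) = turns (xs @ [b, a]) + of_bool (bend b a c) + turns (a # c # ys)"
proof (induction xs)
  case (Cons x xs)
  then show ?case by (cases xs; cases "tl xs") auto
qed simp

lemma turns_rev: "turns (rev l) = turns l"
proof (induction l rule: induct_list012)
  case (3 a b xs)
  then show ?case by (cases xs) (auto simp: turns_append bend_commute)
qed auto

text \<open>Splitting at the top \<open>a\<close>: each leg counts its own corners, read downwards,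
  and only the corner at \<open>a\<close> lies in neither.\<close>

lemma turns_via:
  "turns (rev (b # p) @ a # c # q) = turns (a # b # p) + of_bool (bend b a c) + turns (a # c # q)"
  using turns_append[of "rev p" b a c q] turns_rev[of "a # b # p"] by simp

section \<open>Directions and quadrants\<close>

text \<open>\<open>dx k\<close> and \<open>dy k\<close> are the cosine and sine of \<open>k\<close>
  quarter turns. Directions thus add, and horizontal or vertical is a matter of parity.\<close>

definition dx :: "nat \<Rightarrow> int" where
  "dx k = (if k mod 4 = 0 then 1 else if k mod 4 = 2 then - 1 else 0)"

definition dy :: "nat \<Rightarrow> int" where
  "dy k = (if k mod 4 = 1 then 1 else if k mod 4 = 3 then - 1 else 0)"

lemma direction_cases:
  fixes k :: nat
  obtains "k mod 4 = 0" | "k mod 4 = 1" | "k mod 4 = 2" | "k mod 4 = 3"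
proof -
  have "k mod 4 < 4" by simp
  then show thesis using that by linarith
qed

lemma dx_dy_cases:
  obtains "dx k = 1" "dy k = 0" | "dx k = 0" "dy k = 1" | "dx k = - 1" "dy k = 0" | "dx k = 0" "dy k = - 1"
proof (cases k rule: direction_cases)
  case 1 then show thesis using that(1) by (simp add: dx_def dy_def)
next
  case 2 then show thesis using that(2) by (simp add: dx_def dy_def)
next
  case 3 then show thesis using that(3) by (simp add: dx_def dy_def)
next
  case 4 then show thesis using that(4) by (simp add: dx_def dy_def)
qed

lemma dx_dy_add2: "dx (k + 2) = - dx k" "dy (k + 2) = - dy k"
proof -
  have "(k + 2) mod 4 = (if k mod 4 = 0 then 2 else if k mod 4 = 1 then 3 else if k mod 4 = 2 then 0 else 1)"
    using mod_add_left_eq[of k 4 2] by (cases k rule: direction_cases) simp_all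
  then show "dx (k + 2) = - dx k" "dy (k + 2) = - dy k"
    unfolding dx_def dy_def by (cases k rule: direction_cases; simp)+
qed

lemma dx_eq_0_iff: "dx k = 0 \<longleftrightarrow> odd k" and dy_eq_0_iff: "dy k = 0 \<longleftrightarrow> even k"
proof -
  have "even (k mod 4) = even k" by (rule dvd_mod_iff) simp
  then show "dx k = 0 \<longleftrightarrow> odd k" "dy k = 0 \<longleftrightarrow> even k"
    by (cases k rule: direction_cases; simp add: dx_def dy_def)+
qed

lemma mod_4_add_left_cancel:
  fixes a m n :: nat
  assumes "(a + m) mod 4 = (a + n) mod 4"
  shows "m mod 4 = n mod 4"
proof -
  \<comment> \<open>Adding \<open>3 * a\<close> completes \<open>a\<close> to a multiple of 4 and so
    replaces subtraction on the naturals.\<close>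
  have "((a + m) + 3 * a) mod 4 = ((a + n) + 3 * a) mod 4"
    by (rule mod_add_cong[OF assms refl])
  moreover have "(a + j) + 3 * a = j + a * 4" for j by simp
  ultimately show ?thesis by (simp only: mod_mult_self1)
qed

text \<open>The open quadrant with apex \<open>a\<close> whose axis points in direction \<open>k\<close>: the distance from
  the axis is smaller than the coordinate along it.\<close>

definition quadrant :: "real \<times> real \<Rightarrow> nat \<Rightarrow> (real \<times> real) set" where
  "quadrant a k = {p. \<bar>(fst p - fst a) * dy k - (snd p - snd a) * dx k\<bar>
                    < (fst p - fst a) * dx k + (snd p - snd a) * dy k}"

lemma apex_notin_quadrant: "a \<notin> quadrant a k"
  by (simp add: quadrant_def)

lemma mem_quadrant_iff:
  "k mod 4 = 0 \<Longrightarrow> p \<in> quadrant a k \<longleftrightarrow> \<bar>snd p - snd a\<bar> < fst p - fst a"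
  "k mod 4 = 1 \<Longrightarrow> p \<in> quadrant a k \<longleftrightarrow> \<bar>fst p - fst a\<bar> < snd p - snd a"
  "k mod 4 = 2 \<Longrightarrow> p \<in> quadrant a k \<longleftrightarrow> \<bar>snd p - snd a\<bar> < fst a - fst p"
  "k mod 4 = 3 \<Longrightarrow> p \<in> quadrant a k \<longleftrightarrow> \<bar>fst p - fst a\<bar> < snd a - snd p"
  unfolding quadrant_def mem_Collect_eq by (simp_all add: dx_def dy_def abs_minus_commute)

lemma quadrant_disjoint:
  assumes "k mod 4 \<noteq> l mod 4"
  shows "quadrant a k \<inter> quadrant a l = {}"
proof -
  have False if "p \<in> quadrant a k" "p \<in> quadrant a l" for p
  proof -
    let ?x = "fst p - fst a" and ?y = "snd p - snd a"
    have opp: "fst a - fst p = - ?x" "snd a - snd p = - ?y" by simp_all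
    have "k mod 4 = 0 \<and> \<bar>?y\<bar> < ?x \<or> k mod 4 = 1 \<and> \<bar>?x\<bar> < ?y
        \<or> k mod 4 = 2 \<and> \<bar>?y\<bar> < - ?x \<or> k mod 4 = 3 \<and> \<bar>?x\<bar> < - ?y"
      using that(1) mem_quadrant_iff[of k p a] opp by (metis direction_cases)
    moreover have "l mod 4 = 0 \<and> \<bar>?y\<bar> < ?x \<or> l mod 4 = 1 \<and> \<bar>?x\<bar> < ?y
        \<or> l mod 4 = 2 \<and> \<bar>?y\<bar> < - ?x \<or> l mod 4 = 3 \<and> \<bar>?x\<bar> < - ?y"
      using that(2) mem_quadrant_iff[of l p a] opp by (metis direction_cases)
    ultimately show False using assms by (elim disjE conjE) linarith+
  qed
  then show ?thesis by blast
qed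

lemma abs_convex_comb_less:
  fixes u v :: real
  assumes "\<bar>a\<bar> < b" "\<bar>c\<bar> < d" "0 \<le> u" "0 \<le> v" "u + v = 1"
  shows "\<bar>u * a + v * c\<bar> < u * b + v * d"
proof -
  have "u * \<bar>a\<bar> \<le> u * b" "v * \<bar>c\<bar> \<le> v * d"
    using assms by (auto intro: mult_left_mono)
  moreover have "u * \<bar>a\<bar> < u * b \<or> v * \<bar>c\<bar> < v * d"
    using assms by (cases "u = 0") auto
  moreover have "\<bar>u * a + v * c\<bar> \<le> u * \<bar>a\<bar> + v * \<bar>c\<bar>"
    using assms abs_triangle_ineq[of "u * a" "v * c"] by (simp add: abs_mult)
  ultimately show ?thesis by linarith
qed

lemma convex_quadrant: "convex (quadrant a k)"
proof (rule convexI)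
  fix p q :: "real \<times> real" and u v :: real
  assume pq: "p \<in> quadrant a k" "q \<in> quadrant a k" and uv: "0 \<le> u" "0 \<le> v" "u + v = 1"
  have v: "v = 1 - u" using uv by simp
  show "u *\<^sub>R p + v *\<^sub>R q \<in> quadrant a k"
    using abs_convex_comb_less[OF pq[unfolded quadrant_def mem_Collect_eq] uv]
    unfolding quadrant_def mem_Collect_eq v by (simp add: algebra_simps)
qed

text \<open>The quadrant is a cone: scaling a vector from the apex by a positive factor scales both
  sides of its inequality.\<close>

lemma segment_from_apex:
  assumes "b \<in> quadrant a k"
  shows "closed_segment a b \<subseteq> insert a (quadrant a k)"
proof
  fix p assume "p \<in> closed_segment a b"
  then obtain u where u: "0 \<le> u" "p = (1 - u) *\<^sub>R a + u *\<^sub>R b" by (auto simp: in_segment)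
  show "p \<in> insert a (quadrant a k)"
  proof (cases "u = 0")
    case False
    have "u * \<bar>(fst b - fst a) * dy k - (snd b - snd a) * dx k\<bar>
        < u * ((fst b - fst a) * dx k + (snd b - snd a) * dy k)"
      using assms False u(1) by (simp add: quadrant_def)
    then have "\<bar>u * ((fst b - fst a) * dy k - (snd b - snd a) * dx k)\<bar>
        < u * ((fst b - fst a) * dx k + (snd b - snd a) * dy k)"
      using u(1) by (simp add: abs_mult)
    then have "p \<in> quadrant a k" unfolding quadrant_def u(2) by (simp add: algebra_simps)
    then show ?thesis by simp
  qed (use u in simp)
qed

lemma edge_segment_pair: "edge_segment M {x, y} = closed_segment (plane_point (M x)) (plane_point (M y))"
  by (simp add: edge_segment_def segment_convex_hull)

lemma plane_point_in_quadrant: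
  assumes "\<bar>(fst p - fst a) * dy k - (snd p - snd a) * dx k\<bar>
    < (fst p - fst a) * dx k + (snd p - snd a) * dy k"
  shows "plane_point p \<in> quadrant (plane_point a) k"
  using assms[folded of_int_less_iff[where 'a = real]] unfolding quadrant_def plane_point_def by simp

text \<open>The point deviates from a step of length \<open>l\<close> along the axis by less than
  \<open>l / 2\<close> in each coordinate, so its coordinate along the axis exceeds
  \<open>l / 2\<close> and the other one stays below.\<close>

lemma near_step_in_quadrant:
  fixes x y l :: int
  assumes "2 * \<bar>x - l * dx k\<bar> < l" "2 * \<bar>y - l * dy k\<bar> < l"
  shows "\<bar>x * dy k - y * dx k\<bar> < x * dx k + y * dy k"
proof (cases k rule: dx_dy_cases)
  case 1 show ?thesis using assms unfolding 1 by (smt (verit))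
next
  case 2 show ?thesis using assms unfolding 2 by (smt (verit))
next
  case 3 show ?thesis using assms unfolding 3 by (smt (verit))
next
  case 4 show ?thesis using assms unfolding 4 by (smt (verit))
qed

section \<open>The drawing\<close>

text \<open>\<open>tn y\<close> is the number of quarter turns between the direction into the parent
  of \<open>y\<close> and the direction to \<open>y\<close>: 0 goes straight on, odd values bend, 2
  would run back along the edge just drawn.\<close>

locale drawn_tree = rooted_tree +
  fixes tn :: "'a \<Rightarrow> nat"
  assumes tn_inj: "child x y \<Longrightarrow> child x z \<Longrightarrow> y \<noteq> z \<Longrightarrow> tn y mod 4 \<noteq> tn z mod 4"
    and tn_forward: "child x y \<Longrightarrow> x \<noteq> r \<Longrightarrow> tn y mod 4 \<noteq> 2"
    and tn_heavy: "child x y \<Longrightarrow> x \<noteq> r \<Longrightarrow> odd (tn y) \<Longrightarrow>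
      \<exists>z. child x z \<and> z \<noteq> y \<and> card (sub y) \<le> card (sub z)"
    and tn_heavy_root: "child r y \<Longrightarrow> child r z \<Longrightarrow> y \<noteq> z \<Longrightarrow> odd (tn y + tn z) \<Longrightarrow>
      \<exists>w. child r w \<and> w \<noteq> y \<and> w \<noteq> z \<and> (card (sub y) \<le> card (sub w) \<or> card (sub z) \<le> card (sub w))"
    and centroid: "child r y \<Longrightarrow> 2 * card (sub y) \<le> card V"
begin

text \<open>\<open>D y\<close> is the direction of the edge from the parent of \<open>y\<close> to \<open>y\<close>, counted in quarter
  turns, so that only its residue modulo 4 matters. The positions below include a summand for the
  root, which only translates the drawing.\<close>

definition D :: "'a \<Rightarrow> nat" where
  "D y = sum_list (map tn (P y))"

text \<open>Counting down from \<open>card V\<close> makes the lengths integers that shrink by the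
  factor 3 per level. The subtraction is exact on vertices because a root path has at most
  \<open>card V\<close> of them.\<close>

definition L :: "'a \<Rightarrow> int" where
  "L y = 3 ^ (card V - length (P y))"

definition M :: "'a \<Rightarrow> int \<times> int" where
  "M w = (sum_list (map (\<lambda>z. L z * dx (D z)) (P w)), sum_list (map (\<lambda>z. L z * dy (D z)) (P w)))"

lemma L_pos: "L y > 0"
  by (simp add: L_def)

lemma D_child: "child x y \<Longrightarrow> D y = D x + tn y"
  by (simp add: D_def child_def)

lemma M_child:
  assumes "child x y"
  shows "fst (M y) = fst (M x) + L y * dx (D y)" "snd (M y) = snd (M x) + L y * dy (D y)"
  using assms by (simp_all add: M_def child_def)

lemma length_P: "w \<in> V \<Longrightarrow> length (P w) \<le> card V"
  using P_props(4,5)[of w] finite_V by (metis card_mono distinct_card)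

text \<open>The edges from \<open>y\<close> down to \<open>w\<close> have lengths
  \<open>L y / 3\<close>, \<open>L y / 9\<close> and so on to \<open>L w\<close>, a geometric sum
  equal to \<open>(L y - L w) / 2\<close>.\<close>

lemma M_below:
  assumes "y \<in> V" "w \<in> V" "P w = P y @ b"
  shows "2 * \<bar>fst (M w) - fst (M y)\<bar> \<le> L y - L w \<and> 2 * \<bar>snd (M w) - snd (M y)\<bar> \<le> L y - L w"
  using assms(2,3)
proof (induction b arbitrary: w rule: rev_induct)
  case Nil
  then show ?case by (simp add: M_def L_def)
next
  case (snoc z b)
  have "P y @ b \<noteq> []" using P_props(1)[OF assms(1)] by simp
  then obtain x where x: "child x w" and Px: "x \<in> V" "P x = P y @ b"
    using child_snoc[OF snoc.prems(1), of "P y @ b" z] snoc.prems(2) by (auto simp: child_def)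
  note IH = snoc.IH[OF Px]
  have "length (P w) = Suc (length (P x))" using x by (simp add: child_def)
  then have "card V - length (P x) = Suc (card V - length (P w))"
    using length_P[OF snoc.prems(1)] by simp
  then have L: "L x = 3 * L w" by (simp add: L_def)
  have "\<bar>dx (D w)\<bar> \<le> 1" "\<bar>dy (D w)\<bar> \<le> 1" by (simp_all add: dx_def dy_def)
  then have "\<bar>L w * dx (D w)\<bar> \<le> L w" "\<bar>L w * dy (D w)\<bar> \<le> L w"
    using L_pos[of w] by (simp_all add: abs_mult)
  then have "2 * \<bar>fst (M w) - fst (M y)\<bar> \<le> L y - L w" "2 * \<bar>snd (M w) - snd (M y)\<bar> \<le> L y - L w"
    using IH L unfolding M_child[OF x] by (smt (verit))+
  then show ?case by blast
qed

text \<open>Since \<open>L w > 0\<close>, the vertex \<open>w\<close> deviates from \<open>y\<close>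
  by strictly less than half of the edge from \<open>x\<close> to \<open>y\<close>.\<close>

lemma sub_in_quadrant:
  assumes "child x y" "w \<in> sub y"
  shows "plane_point (M w) \<in> quadrant (plane_point (M x)) (D y)"
proof -
  have "w \<in> V" "y \<in> set (P w)" using assms(2) by (auto simp: sub_def)
  then obtain b where "P w = P y @ b" by (rule P_through)
  moreover have "y \<in> V" using assms(1) by (simp add: child_def)
  ultimately have "2 * \<bar>fst (M w) - fst (M y)\<bar> < L y" "2 * \<bar>snd (M w) - snd (M y)\<bar> < L y"
    using M_below[of y w b] \<open>w \<in> V\<close> L_pos[of w] by auto
  then have "2 * \<bar>fst (M w) - fst (M x) - L y * dx (D y)\<bar> < L y"
    "2 * \<bar>snd (M w) - snd (M x) - L y * dy (D y)\<bar> < L y"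
    using M_child[OF assms(1)] by (simp_all add: algebra_simps)
  then have "\<bar>(fst (M w) - fst (M x)) * dy (D y) - (snd (M w) - snd (M x)) * dx (D y)\<bar>
      < (fst (M w) - fst (M x)) * dx (D y) + (snd (M w) - snd (M x)) * dy (D y)"
    by (rule near_step_in_quadrant)
  then show ?thesis by (rule plane_point_in_quadrant)
qed

lemma parent_in_quadrant:
  assumes "child x y"
  shows "plane_point (M x) \<in> quadrant (plane_point (M y)) (D y + 2)"
proof (rule plane_point_in_quadrant)
  show "\<bar>(fst (M x) - fst (M y)) * dy (D y + 2) - (snd (M x) - snd (M y)) * dx (D y + 2)\<bar>
    < (fst (M x) - fst (M y)) * dx (D y + 2) + (snd (M x) - snd (M y)) * dy (D y + 2)"
    using L_pos[of y] unfolding M_child[OF assms] dx_dy_add2 by (cases "D y" rule: dx_dy_cases) simp_all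
qed

text \<open>Only the edge from \<open>a\<close> to \<open>c\<close> touches the apex. Any other edge
  considered has both ends below \<open>c\<close>, and the quadrant is convex.\<close>

lemma edge_segment_in_quadrant:
  assumes c: "child a c" and z: "child x z" "z \<in> sub c"
  shows "edge_segment M {x, z} \<subseteq>
    quadrant (plane_point (M a)) (D c) \<union> (if a \<in> {x, z} then {plane_point (M a)} else {})"
proof (cases "z = c")
  case True
  then have "x = a" using c z parent_unique by blast
  then show ?thesis
    using segment_from_apex[OF sub_in_quadrant[OF c z(2)]] by (simp add: edge_segment_pair)
next
  case False
  obtain b where b: "P z = P c @ b" using z P_through by (auto simp: sub_def)
  have "x \<in> sub c"
  proof (cases b rule: rev_cases)
    case Nil
    then show ?thesis using b z False P_props(3) c by (metis append_Nil2 child_def)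
  next
    case (snoc b' y)
    then have "P x = P c @ b'" using b z(1) by (simp add: child_def)
    moreover have "c \<in> set (P c)" using c self_in_P by (simp add: child_def)
    ultimately show ?thesis using z(1) by (simp add: sub_def child_def)
  qed
  then have "edge_segment M {x, z} \<subseteq> quadrant (plane_point (M a)) (D c)"
    unfolding edge_segment_pair
    by (intro closed_segment_subset sub_in_quadrant[OF c] z(2) convex_quadrant)
  then show ?thesis by blast
qed

text \<open>Two sets in disjoint quadrants, possibly enlarged by the apex, can share only the apex,
  and only if \<open>a\<close> belongs to both edges.\<close>

lemma Int_subset_apex:
  assumes "S \<subseteq> C \<union> (if a \<in> e then {plane_point (M a)} else {})"
    and "S' \<subseteq> C' \<union> (if a \<in> f then {plane_point (M a)} else {})"
    and "C \<inter> C' = {}" "plane_point (M a) \<notin> C" "plane_point (M a) \<notin> C'"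
  shows "S \<inter> S' \<subseteq> (\<lambda>v. plane_point (M v)) ` (e \<inter> f)"
proof
  fix x assume "x \<in> S \<inter> S'"
  then have "a \<in> e \<inter> f \<and> x = plane_point (M a)"
    using assms by (cases "a \<in> e"; cases "a \<in> f") auto
  then show "x \<in> (\<lambda>v. plane_point (M v)) ` (e \<inter> f)" by blast
qed

section \<open>Absence of crossings\<close>

lemma D_siblings:
  assumes "child x y" "child x z" "y \<noteq> z"
  shows "D y mod 4 \<noteq> D z mod 4"
  using tn_inj[OF assms] mod_4_add_left_cancel[of "D x" "tn y" "tn z"]
  unfolding D_child[OF assms(1)] D_child[OF assms(2)] by blast

lemma D_forward:
  assumes "child x y" "x \<noteq> r"
  shows "(D x + 2) mod 4 \<noteq> D y mod 4"
  using tn_forward[OF assms] mod_4_add_left_cancel[of "D x" 2 "tn y"]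
  unfolding D_child[OF assms(1)] by auto

text \<open>Seen from \<open>y\<close>, the edge to its parent lies in the backward quadrant and the
  lower edge in the quadrant of the child \<open>c\<close>; \<open>tn_forward\<close> separates the
  two.\<close>

lemma segments_ancestor:
  assumes y: "child x y" and z: "child x' z" and below: "P z = P y @ c # q"
  shows "edge_segment M {x, y} \<inter> edge_segment M {x', z} \<subseteq>
    (\<lambda>v. plane_point (M v)) ` ({x, y} \<inter> {x', z})"
proof -
  have V: "y \<in> V" "z \<in> V" using y z by (auto simp: child_def)
  note c = child_on_P[OF V(2,1) below]
  have up: "edge_segment M {x, y} \<subseteq> quadrant (plane_point (M y)) (D y + 2) \<union>
      (if y \<in> {x, y} then {plane_point (M y)} else {})"
    using segment_from_apex[OF parent_in_quadrant[OF y]]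
    by (simp add: edge_segment_pair closed_segment_commute)
  show ?thesis
    by (rule Int_subset_apex[OF up edge_segment_in_quadrant[OF c(1) z c(2)]
          quadrant_disjoint[OF D_forward[OF c(1) child_neq_root[OF y]]] apex_notin_quadrant apex_notin_quadrant])
qed

text \<open>The lowest common ancestor of the lower ends decides: either it is one of them, or the
  edges lie towards two different children and hence in disjoint quadrants.\<close>

lemma segments_meet:
  assumes y: "child x y" and z: "child x' z" and "y \<noteq> z"
  shows "edge_segment M {x, y} \<inter> edge_segment M {x', z} \<subseteq>
    (\<lambda>v. plane_point (M v)) ` ({x, y} \<inter> {x', z})"
proof -
  have V: "y \<in> V" "z \<in> V" using y z by (auto simp: child_def)
  obtain a p q where a: "a \<in> V" "P y = P a @ p" "P z = P a @ q"
    and div: "p = [] \<or> q = [] \<or> hd p \<noteq> hd q"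
    by (rule P_common[OF V])
  have P_inj: "u = w" if "u \<in> V" "w \<in> V" "P u = P w" for u w
    using that P_props(3) by metis
  show ?thesis
  proof (cases p; cases q)
    assume "p = []" "q = []"
    then show ?thesis using a V \<open>y \<noteq> z\<close> P_inj by auto
  next
    fix c q' assume pq: "p = []" "q = c # q'"
    then have "y = a" using a V P_inj by auto
    then show ?thesis using segments_ancestor[OF y z] a pq by blast
  next
    fix c p' assume pq: "p = c # p'" "q = []"
    then have "z = a" using a V P_inj by auto
    then show ?thesis using segments_ancestor[OF z y] a pq by (simp add: Int_commute)
  next
    fix c p' c' q' assume pq: "p = c # p'" "q = c' # q'"
    note c = child_on_P[OF V(1) a(1) a(2)[unfolded pq]]
    note c' = child_on_P[OF V(2) a(1) a(3)[unfolded pq]]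
    have "c \<noteq> c'" using div pq by simp
    show ?thesis
      by (rule Int_subset_apex[OF edge_segment_in_quadrant[OF c(1) y c(2)]
            edge_segment_in_quadrant[OF c'(1) z c'(2)]
            quadrant_disjoint[OF D_siblings[OF c(1) c'(1) \<open>c \<noteq> c'\<close>]] apex_notin_quadrant apex_notin_quadrant])
  qed
qed

text \<open>Relative to the lowest common ancestor \<open>a\<close>, each vertex is the apex or lies
  in the quadrant of its own child of \<open>a\<close>.\<close>

lemma inj_M: "inj_on M V"
proof (rule inj_onI, rule ccontr)
  fix u w assume V: "u \<in> V" "w \<in> V" and eq: "M u = M w" and ne: "u \<noteq> w"
  obtain a p q where a: "a \<in> V" "P u = P a @ p" "P w = P a @ q"
    and div: "p = [] \<or> q = [] \<or> hd p \<noteq> hd q"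
    by (rule P_common[OF V])
  have below: "\<exists>c. hd l = c \<and> child a c \<and> plane_point (M v) \<in> quadrant (plane_point (M a)) (D c)"
    if "v \<in> V" "P v = P a @ l" "l \<noteq> []" for v l
    using that child_on_P[OF that(1) a(1), of "hd l" "tl l"] sub_in_quadrant by simp
  have at: "v = a" if "v \<in> V" "P v = P a @ []" for v
    using that a(1) P_props(3) by (metis append_Nil2)
  consider "p = []" "q = []" | "p = []" "q \<noteq> []" | "p \<noteq> []" "q = []" | "p \<noteq> []" "q \<noteq> []"
    by blast
  then show False
  proof cases
    case 1
    then show False using at[OF V(1)] at[OF V(2)] a ne by simp
  next
    case 2
    then show False using at[OF V(1)] below[OF V(2) a(3)] a eq by (auto simp: apex_notin_quadrant)
  next
    case 3
    then show False using at[OF V(2)] below[OF V(1) a(2)] a eq by (auto simp: apex_notin_quadrant)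
  next
    case 4
    obtain c c' where "child a c" "child a c'" "c \<noteq> c'"
      "plane_point (M u) \<in> quadrant (plane_point (M a)) (D c)"
      "plane_point (M u) \<in> quadrant (plane_point (M a)) (D c')"
      using below[OF V(1) a(2) 4(1)] below[OF V(2) a(3) 4(2)] 4 div eq by auto
    then show False using quadrant_disjoint[OF D_siblings] by blast
  qed
qed

lemma horizontal_child: "child x y \<Longrightarrow> horizontal (M x) (M y) \<longleftrightarrow> even (D y)"
  and vertical_child: "child x y \<Longrightarrow> vertical (M x) (M y) \<longleftrightarrow> odd (D y)"
  using M_child[of x y] L_pos[of y] dx_eq_0_iff[of "D y"] dy_eq_0_iff[of "D y"]
  by (auto simp: horizontal_def vertical_def prod_eq_iff)

lemma edge_child_cases:
  assumes "e \<in> E"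
  obtains x y where "e = {x, y}" "child x y"
  using edge_cases[OF assms] edge_child assms by (metis insert_commute)

lemma M_model: "M \<in> s_models V E"
  unfolding s_models_def mem_Collect_eq
proof (intro conjI allI impI ballI inj_M)
  fix u v assume "{u, v} \<in> E"
  from edge_child[OF this] show "horizontal (M u) (M v) \<or> vertical (M u) (M v)"
    using horizontal_child[of u v] vertical_child[of u v] horizontal_child[of v u] vertical_child[of v u]
    unfolding horizontal_def vertical_def by metis
next
  fix e f assume "e \<in> E" "f \<in> E" "e \<noteq> f"
  then obtain x y x' z where e: "e = {x, y}" "child x y" and f: "f = {x', z}" "child x' z"
    by (metis edge_child_cases)
  \<comment> \<open>An edge is determined by its lower end, as parents are unique.\<close>
  then have "y \<noteq> z" using \<open>e \<noteq> f\<close> parent_unique by blast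
  then show "edge_segment M e \<inter> edge_segment M f \<subseteq> (\<lambda>v. plane_point (M v)) ` (e \<inter> f)"
    using segments_meet e f by blast
qed

section \<open>Bends along tree paths\<close>

lemma bend_down: "child x y \<Longrightarrow> child y z \<Longrightarrow> bend (M x) (M y) (M z) \<longleftrightarrow> odd (tn z)"
  using D_child[of y z] by (auto simp: bend_def horizontal_child vertical_child)

text \<open>Both directions are \<open>D a\<close> plus a turn, so their parities differ exactly
  when the sum of the turns is odd.\<close>

lemma bend_across:
  assumes "child a y" "child a z"
  shows "bend (M y) (M a) (M z) \<longleftrightarrow> odd (tn y + tn z)"
proof -
  have "horizontal (M y) (M a) = horizontal (M a) (M y)" "vertical (M y) (M a) = vertical (M a) (M y)"
    by (auto simp: horizontal_def vertical_def)
  then show ?thesis using D_child assms by (auto simp: bend_def horizontal_child vertical_child)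
qed

text \<open>At a bend into \<open>d\<close> a sibling at least as heavy gives
  \<open>card (sub c) + 1 \<ge> 2 * (card (sub d) + 1)\<close>. The \<open>+ 1\<close> makes the
  doubling exact, and a path without turns needs only \<open>c\<close> itself.\<close>

lemma turns_down:
  assumes "x \<in> V" "w \<in> V" "P w = P x @ c # b"
  shows "2 * 2 ^ turns (map M (x # c # b)) \<le> card (sub c) + 1"
  using assms
proof (induction b arbitrary: x c)
  case Nil
  then have "child x c" using child_on_P by blast
  then have "c \<in> sub c" by (simp add: child_def sub_self)
  then have "card (sub c) > 0" using finite_sub card_gt_0_iff by blast
  then show ?case by simp
next
  case (Cons d b)
  have xc: "child x c" using child_on_P Cons.prems by blast
  then have Pc: "c \<in> V" "P w = P c @ d # b" using Cons.prems by (auto simp: child_def)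
  have cd: "child c d" using child_on_P Cons.prems(2) Pc by blast
  have IH: "2 * 2 ^ turns (map M (c # d # b)) \<le> card (sub d) + 1"
    by (rule Cons.IH[OF Pc(1) Cons.prems(2) Pc(2)])
  have le: "card (sub d) + 1 \<le> card (sub c)"
    using card_sub_children[OF Pc(1), of "{d}"] cd by simp
  show ?case
  proof (cases "odd (tn d)")
    case True
    then obtain z where z: "child c z" "z \<noteq> d" "card (sub d) \<le> card (sub z)"
      using tn_heavy[OF cd child_neq_root[OF xc]] by blast
    have "card (sub d) + card (sub z) + 1 \<le> card (sub c)"
      using card_sub_children[OF Pc(1), of "{d, z}"] cd z by auto
    then show ?thesis using IH z bend_down[OF xc cd] True by simp
  next
    case False
    then show ?thesis using IH le bend_down[OF xc cd] by simp
  qed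
qed

lemma amgm_nat:
  fixes x y :: nat
  shows "4 * x * y \<le> (x + y)\<^sup>2"
proof -
  have "0 \<le> (int x - int y)\<^sup>2" by simp
  then have "int (4 * x * y) \<le> int ((x + y)\<^sup>2)" by (simp add: power2_eq_square algebra_simps)
  then show ?thesis by linarith
qed

lemma path_bends_bound:
  assumes V: "u \<in> V" "w \<in> V" and two: "2 \<le> card V"
  shows "2 ^ (path_bends V E M u w + 4) \<le> (card V + 2)\<^sup>2"
proof -
  obtain a p q where a: "a \<in> V" "P u = P a @ p" "P w = P a @ q"
    and div: "p = [] \<or> q = [] \<or> hd p \<noteq> hd q"
    by (rule P_common[OF V])
  have path: "path_bends V E M u w = turns (map M (rev p @ a # q))"
    by (simp add: path_bends_def tree_path_via[OF V a div])
  \<comment> \<open>This covers paths whose top \<open>a\<close> is one of their ends.\<close>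
  have one_sided: "2 ^ (turns (map M (a # l)) + 4) \<le> (card V + 2)\<^sup>2"
    if "v \<in> V" "P v = P a @ l" for v l
  proof (cases l)
    case Nil
    have "4\<^sup>2 \<le> (card V + 2)\<^sup>2" using two by (intro power_mono) auto
    then show ?thesis using Nil by simp
  next
    case (Cons c l')
    note c = child_on_P[OF that(1) a(1) that(2)[unfolded Cons]]
    define A :: nat where "A = 2 ^ turns (map M (a # l))"
    have "2 * A \<le> card (sub c) + 1"
      using turns_down[OF a(1) that(1) that(2)[unfolded Cons]] Cons by (simp add: A_def)
    moreover have "card (sub c) + 1 \<le> card V"
    proof -
      have "sub c \<subseteq> V - {r}"
        using child_neq_root[OF c(1)] by (auto simp: sub_def)
      then have "card (sub c) \<le> card (V - {r})" using finite_V by (intro card_mono) auto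
      then show ?thesis using two root_in finite_V by simp
    qed
    ultimately have "(2 * A + 2)\<^sup>2 \<le> (card V + 2)\<^sup>2" by (intro power_mono) auto
    \<comment> \<open>The constant 2 stands in for the missing second leg in the AM-GM
      inequality.\<close>
    moreover have "16 * A \<le> (2 * A + 2)\<^sup>2" using amgm_nat[of "2 * A" 2] by simp
    moreover have "2 ^ (turns (map M (a # l)) + 4) = 16 * A" by (simp add: A_def power_add)
    ultimately show ?thesis by linarith
  qed
  show ?thesis
  proof (cases p; cases q)
    assume "p = []" then show ?thesis using one_sided[OF V(2) a(3)] path by simp
  next
    assume "p = []" then show ?thesis using one_sided[OF V(2) a(3)] path by simp
  next
    assume "q = []"
    then have "path_bends V E M u w = turns (map M (a # p))"
      using path turns_rev[of "map M (a # p)"] by (simp add: rev_map)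
    then show ?thesis using one_sided[OF V(1) a(2)] by simp
  next
    fix c p' c' q' assume pq: "p = c # p'" "q = c' # q'"
    note c = child_on_P[OF V(1) a(1) a(2)[unfolded pq]]
    note c' = child_on_P[OF V(2) a(1) a(3)[unfolded pq]]
    have ne: "c \<noteq> c'" using div pq by simp
    define A :: nat where "A = 2 ^ turns (map M (a # p))"
    define B :: nat where "B = 2 ^ turns (map M (a # q))"
    define s where "s = card (sub c)"
    define s' where "s' = card (sub c')"
    have A: "2 * A \<le> s + 1"
      using turns_down[OF a(1) V(1) a(2)[unfolded pq]] pq by (simp add: A_def s_def)
    have B: "2 * B \<le> s' + 1"
      using turns_down[OF a(1) V(2) a(3)[unfolded pq]] pq by (simp add: B_def s'_def)
    \<comment> \<open>The factor 2 accounts for the corner at \<open>a\<close>.\<close>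
    have bends: "2 ^ path_bends V E M u w = A * B * (if bend (M c) (M a) (M c') then 2 else 1)"
      using path turns_via[of "M c" "map M p'" "M a" "M c'" "map M q'"] pq
      by (simp add: rev_map A_def B_def power_add)
    have "s + s' + 1 \<le> card (sub a)"
      using card_sub_children[OF a(1), of "{c, c'}"] c(1) c'(1) ne by (auto simp: s_def s'_def)
    show ?thesis
    proof (cases "a = r")
      case False
      \<comment> \<open>\<open>y\<close> is the child of the root above or equal to
        \<open>a\<close>; the centroid property bounds \<open>sub y\<close> and with it
        \<open>sub a\<close>.\<close>
      obtain y q where y: "P a = r # y # q"
      proof -
        have "P a \<noteq> [r]" using False P_props(3)[OF a(1)] by auto
        then show thesis using that P_props(1,2)[OF a(1)] by (cases "P a"; cases "tl (P a)") auto
      qed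
      have ry: "child r y" "a \<in> sub y" using child_on_P[of a r y q] a(1) root_in y by auto
      have "card (sub a) \<le> card (sub y)"
        using sub_trans[OF ry(2)] finite_sub by (intro card_mono)
      then have "2 * (s + s' + 1) \<le> card V" using centroid[OF ry(1)] \<open>s + s' + 1 \<le> card (sub a)\<close> by simp
      then have "4 * A + 4 * B \<le> card V + 2" using A B by simp
      then have "(4 * A + 4 * B)\<^sup>2 \<le> (card V + 2)\<^sup>2" by (rule power_mono) simp
      moreover have "64 * A * B \<le> (4 * A + 4 * B)\<^sup>2" using amgm_nat[of "4 * A" "4 * B"] by simp
      \<comment> \<open>With or without a bend at \<open>a\<close>, 32 suffices, while the halved
        subtree yields 64.\<close>
      moreover have "2 ^ (path_bends V E M u w + 4) \<le> 32 * A * B" by (simp add: power_add bends)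
      ultimately show ?thesis by linarith
    next
      case True
      then have sa: "sub a = V" using sub_root by simp
      show ?thesis
      proof (cases "bend (M c) (M a) (M c')")
        case False
        have "2 * A + 2 * B \<le> card V + 2" using A B \<open>s + s' + 1 \<le> card (sub a)\<close> sa by simp
        then have "(2 * A + 2 * B)\<^sup>2 \<le> (card V + 2)\<^sup>2" by (rule power_mono) simp
        moreover have "16 * A * B \<le> (2 * A + 2 * B)\<^sup>2" using amgm_nat[of "2 * A" "2 * B"] by simp
        moreover have "2 ^ (path_bends V E M u w + 4) = 16 * A * B"
          using False by (simp add: power_add bends)
        ultimately show ?thesis by linarith
      next
        case bend: True
        then have "odd (tn c + tn c')" using bend_across[OF c(1) c'(1)] by simp
        then obtain k where k: "child a k" "k \<noteq> c" "k \<noteq> c'"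
          "s \<le> card (sub k) \<or> s' \<le> card (sub k)"
          using tn_heavy_root[of c c'] c(1) c'(1) ne True unfolding s_def s'_def by blast
        \<comment> \<open>The third child \<open>k\<close> lets \<open>s\<close> or
          \<open>s'\<close> count twice. This doubles the coefficient of \<open>A\<close> or
          \<open>B\<close>, and AM-GM turns that into the factor 2 lost to the bend at the
          root.\<close>
        have "s + s' + card (sub k) + 1 \<le> card V"
          using card_sub_children[OF a(1), of "{c, c', k}"] c(1) c'(1) ne k sa
          by (simp add: s_def s'_def)
        then consider "2 * A + 4 * B \<le> card V + 2" | "4 * A + 2 * B \<le> card V + 2"
          using k(4) A B by linarith
        then have "32 * A * B \<le> (card V + 2)\<^sup>2"
        proof cases
          case 1
          then have "(2 * A + 4 * B)\<^sup>2 \<le> (card V + 2)\<^sup>2" by (rule power_mono) simp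
          moreover have "32 * A * B \<le> (2 * A + 4 * B)\<^sup>2" using amgm_nat[of "2 * A" "4 * B"] by simp
          ultimately show ?thesis by linarith
        next
          case 2
          then have "(4 * A + 2 * B)\<^sup>2 \<le> (card V + 2)\<^sup>2" by (rule power_mono) simp
          moreover have "32 * A * B \<le> (4 * A + 2 * B)\<^sup>2" using amgm_nat[of "4 * A" "2 * B"] by simp
          ultimately show ?thesis by linarith
        qed
        moreover have "2 ^ (path_bends V E M u w + 4) = 32 * A * B"
          using bend by (simp add: power_add bends)
        ultimately show ?thesis by linarith
      qed
    qed
  qed
qed

end

section \<open>Choice of the turns\<close>

text \<open>Rank 0 goes to a largest value. The induction inserts elements in order of decreasing
  \<open>f\<close>, so each new one takes the last rank.\<close>

lemma ranking_exists:
  fixes f :: "'a \<Rightarrow> nat"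
  assumes "finite S"
  shows "\<exists>R. bij_betw R S {..<card S} \<and> (\<forall>y\<in>S. \<forall>z\<in>S. R y < R z \<longrightarrow> f z \<le> f y)"
  using assms
proof (induction S rule: finite_ranking_induct[where f = "\<lambda>x. - int (f x)"])
  case empty
  then show ?case by (simp add: bij_betw_def)
next
  case (insert x S)
  show ?case
  proof (cases "x \<in> S")
    case True
    then show ?thesis using insert.IH by (simp add: insert_absorb)
  next
    case False
    obtain R where R: "bij_betw R S {..<card S}" "\<forall>y\<in>S. \<forall>z\<in>S. R y < R z \<longrightarrow> f z \<le> f y"
      using insert.IH by blast
    let ?R = "R(x := card S)"
    have "bij_betw ?R S {..<card S}"
      using R(1) False by (subst bij_betw_cong[of S ?R R]) auto
    then have "bij_betw ?R (insert x S) (insert (card S) {..<card S})"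
      using notIn_Un_bij_betw[of x S ?R "{..<card S}"] False by simp
    then have "bij_betw ?R (insert x S) {..<card (insert x S)}"
      using False insert.hyps by (simp add: lessThan_Suc)
    moreover have "R y < card S" if "y \<in> S" for y
      using R(1) that by (auto simp: bij_betw_def)
    then have "\<forall>y\<in>insert x S. \<forall>z\<in>insert x S. ?R y < ?R z \<longrightarrow> f z \<le> f y"
      using R(2) insert.hyps False by (auto dest: less_asym)
    ultimately show ?thesis by blast
  qed
qed

section \<open>Turns chosen by ranking the children\<close>

context rooted_tree
begin

lemma finite_children: "finite {y. child x y}"
  using finite_V by (rule finite_subset[rotated]) (auto simp: child_def)

lemma card_children: "card {y. child x y} \<le> degree_of E x"
  unfolding degree_of_def
proof (rule card_inj_on_le)
  show "inj_on (\<lambda>y. {x, y}) {y. child x y}" by (auto simp: inj_on_def doubleton_eq_iff)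
  show "(\<lambda>y. {x, y}) ` {y. child x y} \<subseteq> {e \<in> E. x \<in> e}" using child_edge by auto
qed (use finite_E in simp)

text \<open>The edge to the parent is incident with \<open>x\<close> but leads to no child.\<close>

lemma card_children_nonroot:
  assumes "x \<in> V" "x \<noteq> r"
  shows "card {y. child x y} < degree_of E x"
proof -
  obtain p where p: "child p x" using parent_exists[OF assms] .
  have "card {y. child x y} \<le> card ({e \<in> E. x \<in> e} - {{p, x}})"
  proof (rule card_inj_on_le)
    show "inj_on (\<lambda>y. {x, y}) {y. child x y}" by (auto simp: inj_on_def doubleton_eq_iff)
    have "\<not> child x p" using p by (auto simp: child_def)
    then show "(\<lambda>y. {x, y}) ` {y. child x y} \<subseteq> {e \<in> E. x \<in> e} - {{p, x}}"
      using child_edge by (auto simp: doubleton_eq_iff)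
  qed (use finite_E in simp)
  also have "\<dots> < card {e \<in> E. x \<in> e}"
    using child_edge[OF p] finite_E by (intro psubset_card_mono) auto
  finally show ?thesis by (simp add: degree_of_def)
qed

lemma turning_exists:
  assumes deg: "\<And>v. v \<in> V \<Longrightarrow> degree_of E v \<le> 4"
    and centroid: "\<And>y. child r y \<Longrightarrow> 2 * card (sub y) \<le> card V"
  shows "\<exists>tn. drawn_tree V E r tn"
proof -
  have "\<forall>x. \<exists>R. bij_betw R {y. child x y} {..<card {y. child x y}} \<and>
      (\<forall>y\<in>{y. child x y}. \<forall>z\<in>{y. child x y}. R y < R z \<longrightarrow> card (sub z) \<le> card (sub y))"
    by (intro allI ranking_exists finite_children)
  then obtain R where R: "\<And>x. bij_betw (R x) {y. child x y} {..<card {y. child x y}}"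
    and heavier: "\<And>x y z. child x y \<Longrightarrow> child x z \<Longrightarrow> R x y < R x z \<Longrightarrow> card (sub z) \<le> card (sub y)"
    by (metis mem_Collect_eq)
  have R_inj: "R x y \<noteq> R x z" if "child x y" "child x z" "y \<noteq> z" for x y z
    using R[of x] that by (auto simp: bij_betw_def inj_on_def)
  have R_less: "R x y < card {y. child x y}" if "child x y" for x y
    using R[of x] that by (auto simp: bij_betw_def)
  have R_ex: "\<exists>z. child x z \<and> R x z = i" if "child x y" "i < R x y" for x y i
  proof -
    have "i \<in> R x ` {y. child x y}"
      using R[of x] R_less[OF that(1)] that(2) by (simp add: bij_betw_def)
    then show ?thesis by auto
  qed
  have R_root: "R r y < 4" if "child r y" for y
    using R_less[OF that] card_children[of r] deg[OF root_in] by linarith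
  have R_nonroot: "R x y < 3" if "child x y" "x \<noteq> r" for x y
  proof -
    have "x \<in> V" using that by (simp add: child_def)
    then show ?thesis
      using R_less[OF that(1)] card_children_nonroot[of x] deg[of x] that(2) by linarith
  qed
  \<comment> \<open>At the root, \<open>f\<close> puts ranks 0 and 1 opposite each other and
    likewise ranks 2 and 3. Elsewhere \<open>g\<close> sends rank 0 straight on, the others
    sideways, and never backwards.\<close>
  define f :: "nat \<Rightarrow> nat" where "f i = (if i = 0 then 0 else if i = 1 then 2 else if i = 2 then 1 else 3)" for i
  define g :: "nat \<Rightarrow> nat" where "g i = (if i = 0 then 0 else if i = 1 then 1 else 3)" for i
  define par where "par y = (THE x. child x y)" for y
  have par: "par y = x" if "child x y" for x y
    unfolding par_def using that parent_unique by blast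
  \<comment> \<open>At \<open>r\<close> the value of \<open>par\<close>, and so \<open>tn r\<close>,
    is unspecified; it enters every \<open>D\<close> of a vertex as the same summand.\<close>
  define tn where "tn y = (if par y = r then f (R r y) else g (R (par y) y))" for y
  have f_inj: "f i mod 4 \<noteq> f j mod 4" if "i < 4" "j < 4" "i \<noteq> j" for i j
    using that by (auto simp: f_def)
  have g_inj: "g i mod 4 \<noteq> g j mod 4" if "i < 3" "j < 3" "i \<noteq> j" for i j
    using that by (auto simp: g_def)
  have "drawn_tree V E r tn"
  proof unfold_locales
    fix x y z assume *: "child x y" "child x z" "y \<noteq> z"
    show "tn y mod 4 \<noteq> tn z mod 4"
    proof (cases "x = r")
      case True
      then show ?thesis using f_inj[OF R_root R_root R_inj] * par by (simp add: tn_def)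
    next
      case False
      then show ?thesis
        using g_inj[OF R_nonroot[OF *(1)] R_nonroot[OF *(2)] R_inj[OF *]] par[OF *(1)] par[OF *(2)]
        by (simp add: tn_def)
    qed
  next
    fix x y assume "child x y" "x \<noteq> r"
    then show "tn y mod 4 \<noteq> 2" using par by (simp add: tn_def g_def)
  next
    fix x y assume xy: "child x y" "x \<noteq> r" "odd (tn y)"
    then have "0 < R x y" using par[OF xy(1)] by (auto simp: tn_def g_def split: if_splits)
    then obtain z where "child x z" "R x z = 0" using R_ex[OF xy(1)] by blast
    then show "\<exists>z. child x z \<and> z \<noteq> y \<and> card (sub y) \<le> card (sub z)"
      using heavier[of x z y] xy(1) \<open>0 < R x y\<close> by auto
  next
    have third: "\<exists>w. child r w \<and> w \<noteq> y \<and> w \<noteq> z \<and> card (sub z) \<le> card (sub w)"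
      if z: "child r z" "1 < R r z" and y: "R r y \<le> 1" for y z
    proof -
      \<comment> \<open>\<open>1 - R r y\<close> is the other of the two top ranks, so its child
        differs from \<open>y\<close> and is at least as heavy as \<open>z\<close>.\<close>
      have "1 - R r y < R r z" using z(2) by linarith
      then obtain w where w: "child r w" "R r w = 1 - R r y" using R_ex[OF z(1)] by blast
      have "R r w \<noteq> R r y" using w(2) y by presburger
      then show ?thesis using w heavier[OF w(1) z(1)] \<open>1 - R r y < R r z\<close> by auto
    qed
    fix y z assume yz: "child r y" "child r z" "y \<noteq> z" "odd (tn y + tn z)"
    \<comment> \<open>An odd sum means that \<open>y\<close> and \<open>z\<close> come from
      different opposite pairs.\<close>
    then have "R r y \<le> 1 \<and> 1 < R r z \<or> R r z \<le> 1 \<and> 1 < R r y"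
      using par by (auto simp: tn_def f_def split: if_splits)
    then show "\<exists>w. child r w \<and> w \<noteq> y \<and> w \<noteq> z \<and> (card (sub y) \<le> card (sub w) \<or> card (sub z) \<le> card (sub w))"
      using third yz(1,2) by blast
  qed (rule centroid)
  then show ?thesis by blast
qed

end

section \<open>From the integer inequality to the logarithmic bound\<close>

theorem theorem3:
  fixes V :: "'a set" and E :: "'a set set" and n :: nat
  assumes "tree_graph V E" and "card V = n" and "max_degree V E \<le> 4"
  shows "bend_number V E \<le> ereal (2 * log 2 (real n + 2) - 4)"
proof -
  interpret tree V E by unfold_locales (rule assms(1))
  have deg: "degree_of E v \<le> 4" if "v \<in> V" for v
  proof -
    have "degree_of E v \<le> max_degree V E"
      unfolding max_degree_def using that finite_V by (intro Max_ge) auto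
    then show ?thesis using assms(3) by simp
  qed
  obtain r where r: "rooted_tree V E r"
    "\<And>y. rooted_tree.child V E r r y \<Longrightarrow> 2 * card (rooted_tree.sub V E r y) \<le> card V"
    by (rule centroid_exists) blast
  obtain tn where "drawn_tree V E r tn"
    using rooted_tree.turning_exists[OF r(1) deg r(2)] by blast
  then interpret drawn_tree V E r tn .
  have "ereal (real (path_bends V E M u w)) \<le> ereal (2 * log 2 (real n + 2) - 4)"
    if "u \<in> leaves V E" "w \<in> leaves V E" for u w
  proof -
    have uw: "u \<in> V" "w \<in> V" using that by (auto simp: leaves_def)
    \<comment> \<open>A leaf lies on an edge, so there are at least two vertices. For one vertex
      there are no leaves, and the empty supremum, minus infinity, satisfies the bound.\<close>
    have "{e \<in> E. u \<in> e} \<noteq> {}"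
      using that(1) by (auto simp: leaves_def degree_of_def card_1_singleton_iff)
    then obtain x y where "{x, y} \<in> E" using edge_cases by blast
    then have "{x, y} \<subseteq> V" "card {x, y} = 2" using edgeD[of x y] by auto
    then have "2 \<le> card V" using card_mono[OF finite_V] by metis
    then have "2 ^ (path_bends V E M u w + 4) \<le> (n + 2)\<^sup>2"
      using path_bends_bound[OF uw] assms(2) by simp
    then have "real (2 ^ (path_bends V E M u w + 4)) \<le> real ((n + 2)\<^sup>2)"
      by (simp only: of_nat_le_iff)
    then have "2 ^ (path_bends V E M u w + 4) \<le> (real n + 2)\<^sup>2"
      by (simp only: of_nat_power of_nat_add of_nat_numeral)
    then have "log 2 (2 ^ (path_bends V E M u w + 4)) \<le> log 2 ((real n + 2)\<^sup>2)"
      by (subst log_le_cancel_iff) auto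
    moreover have "log 2 (2 ^ (path_bends V E M u w + 4)) = real (path_bends V E M u w + 4)"
      by (subst log_nat_power) auto
    moreover have "log 2 ((real n + 2)\<^sup>2) = 2 * log 2 (real n + 2)"
      by (subst log_nat_power) auto
    ultimately have "real (path_bends V E M u w) + 4 \<le> 2 * log 2 (real n + 2)"
      by simp
    then show ?thesis by simp
  qed
  then have "model_bends V E M \<le> ereal (2 * log 2 (real n + 2) - 4)"
    unfolding model_bends_def by (intro SUP_least) auto
  then show ?thesis
    unfolding bend_number_def by (rule INF_lower2[OF M_model])
qed

end
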